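(* Let $d_1\le d_2\le\ldots\le d_n$ be the degree sequence of a graph $G$, and let $\delta=d_1$ be its minimum degree. If $d_\delta+d_{\delta+1}\ge n$, then $G$ is Hamiltonian.
   Context: Graphs are finite and undirected, with neither loops nor multiple edges. The order $n$ of $G$ is its number of vertices. The degree sequence $d_1\le d_2\le\ldots\le d_n$ lists the degrees of all $n$ vertices of $G$ in nondecreasing order, indexed from $1$; its first term $d_1$ is the minimum degree of $G$, denoted $\delta$. Thus $d_\delta$ and $d_{\delta+1}$ are the $\delta$-th and $(\delta+1)$-th terms of this sequence. A graph is Hamiltonian if it contains a Hamilton cycle, that is, a simple spanning cycle.
   Formalization: The graph is assumed to have order n ≥ 3; this excludes the complete graph on two vertices, which satisfies the degree condition (1 + 1 ≥ 2) but has no Hamilton cycle. *)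

theory Defs
  imports "Graph_Theory.Graph_Theory" "HOL-Library.Multiset"
begin

text \<open>
  Finite simple undirected graphs are represented by the locale \<^locale>\<open>graph\<close>: finite
  loop-free digraphs without parallel arcs whose adjacency relation is symmetric. An undirected
  edge is a pair of opposite arcs, so the degree of a vertex is its out-degree.
\<close>

definition degree_sequence :: "('a, 'b) pre_digraph \<Rightarrow> nat list" where
  "degree_sequence G = sorted_list_of_multiset (image_mset (out_degree G) (mset_set (verts G)))"

text \<open>
  The terms are indexed from 1 to the order of the graph. Index 0 arises below only when the
  minimum degree is 0; truncated subtraction then yields the first term, which is 0.
\<close>

definition degree_term :: "('a, 'b) pre_digraph \<Rightarrow> nat \<Rightarrow> nat" where
  "degree_term G i = degree_sequence G ! (i - 1)"

text \<open>
  The library's \<^const>\<open>pre_digraph.cycle\<close> is a nonempty closed directed walk without repeated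
  vertices; in a symmetric digraph this includes walking along an edge and back. Length at least 3
  excludes that, leaving exactly the cycles of the undirected graph. The vertices of a cycle are
  the tails of its arcs.
\<close>

definition hamilton_cycle :: "('a, 'b) pre_digraph \<Rightarrow> 'b awalk \<Rightarrow> bool" where
  "hamilton_cycle G p \<longleftrightarrow>
     pre_digraph.cycle G p \<and> length p \<ge> 3 \<and> tail G ` set p = verts G"

definition hamiltonian :: "('a, 'b) pre_digraph \<Rightarrow> bool" where
  "hamiltonian G \<longleftrightarrow> (\<exists>p. hamilton_cycle G p)"

end

theory Submission
  imports Defs
begin

text \<open>
  Call a symmetric relation Ore-closed if it joins any two distinct vertices whose degrees sum to
  at least \<open>n\<close>. By the Bondy--Chvatal argument, a maximal non-Hamiltonian graph containing
  \<open>G\<close> is Ore-closed. Since \<open>2 d\<^sub>\<delta>\<^sub>+\<^sub>1 \<ge> n\<close>, such a graph joins all vertices from index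
  \<open>\<delta> + 1\<close> on to each other, and the vertex of index \<open>\<delta>\<close> to all of them. These form a clique of
  \<open>n - \<delta> + 1\<close> vertices, whose degrees are at least \<open>n - \<delta>\<close>; as every degree is at least \<open>\<delta>\<close>,
  they are joined to all vertices. Now every degree exceeds \<open>n - \<delta>\<close>, so the graph is complete, a
  contradiction.
\<close>

section \<open>Spanning cycles and the Bondy-Chvatal step\<close>

text \<open>A cyclic order of the vertices, cut open at an arbitrary place. Length is not
  restricted, so a single edge on two vertices counts; where this matters, at least three vertices
  are assumed.\<close>

definition spanning_cycle :: "'a set \<Rightarrow> ('a \<times> 'a) set \<Rightarrow> 'a list \<Rightarrow> bool" where
  "spanning_cycle V F xs \<longleftrightarrow> distinct xs \<and> set xs = V \<and>
     successively (\<lambda>x y. (x, y) \<in> F) xs \<and> (last xs, hd xs) \<in> F"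

definition ore_closed :: "'a set \<Rightarrow> ('a \<times> 'a) set \<Rightarrow> bool" where
  "ore_closed V F \<longleftrightarrow> (\<forall>u\<in>V. \<forall>v\<in>V. u \<noteq> v \<longrightarrow>
     card (F `` {u}) + card (F `` {v}) \<ge> card V \<longrightarrow> (u, v) \<in> F)"

lemma spanning_cycle_rotate:
  assumes "spanning_cycle V F (xs @ ys)" "xs \<noteq> []" "ys \<noteq> []"
  shows "spanning_cycle V F (ys @ xs)"
  using assms unfolding spanning_cycle_def by (auto simp: successively_append_iff)

lemma not_successively_split:
  assumes "\<not> successively P xs"
  obtains ys zs where "xs = ys @ zs" "ys \<noteq> []" "zs \<noteq> []" "\<not> P (last ys) (hd zs)"
proof -
  from assms obtain i where i: "Suc i < length xs" "\<not> P (xs ! i) (xs ! Suc i)"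
    unfolding successively_conv_nth by blast
  show ?thesis
  proof
    show "xs = take (Suc i) xs @ drop (Suc i) xs" by simp
    show "take (Suc i) xs \<noteq> []" "drop (Suc i) xs \<noteq> []" using i(1) by auto
    show "\<not> P (last (take (Suc i) xs)) (hd (drop (Suc i) xs))"
      using i by (simp add: take_Suc_conv_app_nth hd_drop_conv_nth)
  qed
qed

text \<open>Ore's crossing argument: if position \<open>i\<close> on the path is adjacent to the
  last vertex and position \<open>Suc i\<close> to the first, then running up to \<open>i\<close>,
  jumping to the end and returning backwards to \<open>Suc i\<close> gives a cycle. The degree sum
  forces such an \<open>i\<close>.\<close>

lemma spanning_path_to_cycle:
  assumes "sym F" "irrefl F" "F \<subseteq> V \<times> V"
    and xs: "distinct xs" "set xs = V" "xs \<noteq> []" "successively (\<lambda>x y. (x, y) \<in> F) xs"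
    and deg: "card (F `` {hd xs}) + card (F `` {last xs}) \<ge> card V"
  shows "\<exists>ys. spanning_cycle V F ys"
proof -
  define m where "m = length xs"
  have m: "m \<ge> 1" "card V = m"
    using xs distinct_card[of xs] by (auto simp: m_def Suc_le_eq)
  define A where "A = {i. i < m - 1 \<and> (hd xs, xs ! Suc i) \<in> F}"
  define B where "B = {i. i < m - 1 \<and> (last xs, xs ! i) \<in> F}"
  have fin: "finite A" "finite B" by (auto simp: A_def B_def)
  have "F `` {hd xs} \<subseteq> (\<lambda>i. xs ! Suc i) ` A"
  proof
    fix w assume "w \<in> F `` {hd xs}"
    then have w: "(hd xs, w) \<in> F" by simp
    then obtain k where k: "k < m" "xs ! k = w"
      using assms(3) xs(2) by (metis SigmaD2 in_set_conv_nth m_def subsetD)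
    \<comment> \<open>Without loops, each neighbour of the first vertex has a predecessor on the
      path, so \<open>A\<close> misses none.\<close>
    have "k \<noteq> 0" using w k xs(3) assms(2) by (metis hd_conv_nth irreflD)
    then obtain i where "k = Suc i" using not0_implies_Suc by blast
    then show "w \<in> (\<lambda>i. xs ! Suc i) ` A" using k w by (auto simp: A_def)
  qed
  then have cA: "card (F `` {hd xs}) \<le> card A"
    using fin(1) by (rule surj_card_le[rotated])
  have "F `` {last xs} \<subseteq> (!) xs ` B"
  proof
    fix w assume "w \<in> F `` {last xs}"
    then have w: "(last xs, w) \<in> F" by simp
    then obtain k where k: "k < m" "xs ! k = w"
      using assms(3) xs(2) by (metis SigmaD2 in_set_conv_nth m_def subsetD)
    have "k \<noteq> m - 1" using w k xs(3) assms(2) by (auto simp: last_conv_nth irrefl_def m_def)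
    then show "w \<in> (!) xs ` B" using k w by (auto simp: B_def)
  qed
  then have cB: "card (F `` {last xs}) \<le> card B"
    using fin(2) by (rule surj_card_le[rotated])
  \<comment> \<open>Both sets live in the \<open>m - 1\<close> gaps of the path, but their sizes sum
    to at least \<open>m\<close>.\<close>
  have "A \<inter> B \<noteq> {}"
  proof
    assume "A \<inter> B = {}"
    then have "card A + card B = card (A \<union> B)" using fin by (simp add: card_Un_disjoint)
    also have "\<dots> \<le> card {..<m - 1}" by (rule card_mono) (auto simp: A_def B_def)
    finally show False using cA cB deg m by simp
  qed
  then obtain i where i: "i < m - 1" "(hd xs, xs ! Suc i) \<in> F" "(last xs, xs ! i) \<in> F"
    by (auto simp: A_def B_def)
  define ys zs where "ys = take (Suc i) xs" and "zs = drop (Suc i) xs"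
  have eq: "xs = ys @ zs" by (simp add: ys_def zs_def)
  have ne: "ys \<noteq> []" "zs \<noteq> []" using i(1) by (auto simp: ys_def zs_def m_def)
  have "last ys = xs ! i" "hd zs = xs ! Suc i"
    using i(1) by (auto simp: ys_def zs_def m_def take_Suc_conv_app_nth hd_drop_conv_nth)
  moreover have "hd ys = hd xs" "last zs = last xs"
    using ne unfolding eq by simp_all
  ultimately have ends: "last ys = xs ! i" "hd zs = xs ! Suc i" "hd ys = hd xs" "last zs = last xs"
    by simp_all
  have joins: "(last ys, last zs) \<in> F" "(hd zs, hd ys) \<in> F"
    using symD[OF assms(1) i(2)] symD[OF assms(1) i(3)] ends by simp_all
  have parts: "successively (\<lambda>x y. (x, y) \<in> F) ys" "successively (\<lambda>x y. (x, y) \<in> F) zs"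
    using xs(4) unfolding eq successively_append_iff by simp_all
  moreover have "successively (\<lambda>x y. (y, x) \<in> F) zs"
    using parts(2) by (rule successively_mono) (rule symD[OF assms(1)])
  ultimately have "successively (\<lambda>x y. (x, y) \<in> F) (ys @ rev zs)"
    using joins(1) by (simp add: successively_append_iff hd_rev)
  moreover have "(last (ys @ rev zs), hd (ys @ rev zs)) \<in> F"
    using joins(2) ne by (simp add: last_rev)
  moreover have "distinct (ys @ rev zs)" "set (ys @ rev zs) = V"
    using xs(1,2) unfolding eq by auto
  ultimately show ?thesis unfolding spanning_cycle_def by blast
qed

text \<open>A cycle through the new edge, cut at that edge, is a spanning path in \<open>F\<close>
  between \<open>u\<close> and \<open>v\<close>, to which the crossing argument applies.\<close>

lemma bondy_chvatal:
  assumes F: "sym F" "irrefl F" "F \<subseteq> V \<times> V"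
    and n: "card V \<ge> 3"
    and deg: "card (F `` {u}) + card (F `` {v}) \<ge> card V"
    and cyc: "spanning_cycle V (F \<union> {(u, v), (v, u)}) xs"
  shows "\<exists>ys. spanning_cycle V F ys"
proof (cases "spanning_cycle V F xs")
  case False
  let ?F = "F \<union> {(u, v), (v, u)}"
  \<comment> \<open>Rotate until a pair outside \<open>F\<close> is the closing pair. It is then the
    new edge, so \<open>u\<close> and \<open>v\<close> are the ends of the list.\<close>
  obtain ys where ys: "spanning_cycle V ?F ys" "(last ys, hd ys) \<notin> F"
  proof (cases "(last xs, hd xs) \<in> F")
    case True
    then have "\<not> successively (\<lambda>x y. (x, y) \<in> F) xs"
      using False cyc by (auto simp: spanning_cycle_def)
    then obtain as bs where "xs = as @ bs" "as \<noteq> []" "bs \<noteq> []" "(last as, hd bs) \<notin> F"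
      by (rule not_successively_split)
    then show ?thesis
      using spanning_cycle_rotate[of V ?F as bs] cyc that[of "bs @ as"] by simp
  qed (use cyc that in blast)
  have dist: "distinct ys" and set: "set ys = V"
    and succ: "successively (\<lambda>x y. (x, y) \<in> ?F) ys" and lh: "(last ys, hd ys) \<in> ?F"
    using ys(1) by (auto simp: spanning_cycle_def)
  have len: "length ys \<ge> 3" using n distinct_card[OF dist] set by simp
  have ends: "{u, v} = {ys ! 0, ys ! (length ys - 1)}"
    using lh ys(2) len hd_conv_nth[of ys] last_conv_nth[of ys] by fastforce
  have "successively (\<lambda>x y. (x, y) \<in> F) ys"
    unfolding successively_conv_nth
  proof (intro allI impI)
    fix i assume i: "Suc i < length ys"
    show "(ys ! i, ys ! Suc i) \<in> F"
    proof (rule ccontr)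
      assume "(ys ! i, ys ! Suc i) \<notin> F"
      \<comment> \<open>A second use of the new edge would make two consecutive positions the two
        end positions, impossible for length at least 3.\<close>
      then have "{ys ! i, ys ! Suc i} = {ys ! 0, ys ! (length ys - 1)}"
        using successively_nth[OF succ i] ends by auto
      moreover have "ys ! a = ys ! b \<longleftrightarrow> a = b" if "a \<in> {i, Suc i}" "b \<in> {0, length ys - 1}" for a b
        using that i dist by (intro nth_eq_iff_index_eq) auto
      ultimately show False
        using i len by (auto simp: doubleton_eq_iff)
    qed
  qed
  moreover have "card (F `` {hd ys}) + card (F `` {last ys}) \<ge> card V"
    using lh ys(2) deg by auto
  ultimately show ?thesis
    using spanning_path_to_cycle[OF F dist set] len by fastforce
qed blast

section \<open>The degree condition and maximal graphs without spanning cycle\<close>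

text \<open>\<open>k\<close>, \<open>p\<close> and \<open>q\<close> stand for
  \<open>\<delta>\<close>, \<open>d \<delta>\<close> and \<open>d (\<delta> + 1)\<close>; as
  \<open>f\<close> counts from 0, the vertex of index \<open>\<delta>\<close> is
  \<open>f (k - 1)\<close>. Degrees are only bounded below, so bounds from a graph carry over to any
  larger one.\<close>

lemma ore_closed_complete:
  assumes F: "sym F" "F \<subseteq> V \<times> V" "ore_closed V F"
    and f: "bij_betw f {..<n} V"
    and k: "0 < k" "k < n"
    and min: "\<And>i. i < n \<Longrightarrow> k \<le> card (F `` {f i})"
    and low: "p \<le> card (F `` {f (k - 1)})"
    and high: "\<And>i. k \<le> i \<Longrightarrow> i < n \<Longrightarrow> q \<le> card (F `` {f i})"
    and pq: "p \<le> q" "n \<le> p + q"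
    and ij: "i < n" "j < n" "i \<noteq> j"
  shows "(f i, f j) \<in> F"
proof -
  have inj: "inj_on f {..<n}" and cV: "card V = n" and fV: "\<And>i. i < n \<Longrightarrow> f i \<in> V"
    using f bij_betw_same_card[OF f] by (auto simp: bij_betw_def)
  have finV: "finite V" using f bij_betw_finite by blast
  have closed: "(f i, f j) \<in> F"
    if "i < n" "j < n" "i \<noteq> j" "n \<le> a + b" "a \<le> card (F `` {f i})" "b \<le> card (F `` {f j})" for i j a b
    using F(3) that fV inj_onD[OF inj, of i j] unfolding ore_closed_def cV by fastforce
  have finN: "finite (F `` {x})" for x
    using F(2) finV by (auto intro: finite_subset)
  have card_ge: "card I \<le> card (F `` {x})"
    if "I \<subseteq> {..<n}" "\<And>i. i \<in> I \<Longrightarrow> (x, f i) \<in> F" for I x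
  proof -
    have "card I = card (f ` I)" using that(1) inj by (metis card_image inj_on_subset)
    also have "\<dots> \<le> card (F `` {x})" using that(2) finN by (intro card_mono) auto
    finally show ?thesis .
  qed
  have A: "(f i, f j) \<in> F" if "k \<le> i" "k \<le> j" "i < n" "j < n" "i \<noteq> j" for i j
    using that pq by (intro closed[of i j q q] high) auto
  have B: "(f (k - 1), f j) \<in> F" if "k \<le> j" "j < n" for j
    using that pq k by (intro closed[of _ j p q] high low) auto
  have clique: "(f i, f j) \<in> F"
    if bounds: "k - 1 \<le> i" "k - 1 \<le> j" "i < n" "j < n" "i \<noteq> j" for i j
  proof -
    consider "k \<le> i" "k \<le> j" | "i = k - 1" "k \<le> j" | "k \<le> i" "j = k - 1"
      using bounds by arith
    then show ?thesis
    proof cases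
      case 1
      then show ?thesis using A bounds by simp
    next
      case 2
      then show ?thesis using B bounds by simp
    next
      case 3
      then show ?thesis using symD[OF F(1) B[of i]] bounds by simp
    qed
  qed
  \<comment> \<open>The clique fills positions \<open>k - 1\<close> to \<open>n - 1\<close>, that is
    \<open>n - k + 1\<close> of them; dropping \<open>i\<close> leaves \<open>n - k\<close>.\<close>
  have deg_clique: "n - k \<le> card (F `` {f i})" if "k - 1 \<le> i" "i < n" for i
  proof -
    have "card ({k - 1..<n} - {i}) \<le> card (F `` {f i})"
      using clique[of i] that by (intro card_ge) auto
    then show ?thesis using that k by simp
  qed
  have join: "(f i, f j) \<in> F" if "k - 1 \<le> i" "i < n" "j < n" "i \<noteq> j" for i j
    using closed[OF that(2-4) _ deg_clique[OF that(1,2)] min[OF that(3)]] k by simp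
  show ?thesis
  proof (cases "k - 1 \<le> i")
    case False
    \<comment> \<open>A vertex outside the clique is joined to all of it, so its degree is at least
      \<open>n - k + 1\<close>.\<close>
    have "(f i, f j) \<in> F" if "j \<in> {k - 1..<n}" for j
      using symD[OF F(1) join[of j i]] that ij(1) False by auto
    then have "card {k - 1..<n} \<le> card (F `` {f i})"
      by (intro card_ge) auto
    then show ?thesis using closed[OF ij _ _ min[OF ij(2)], of "card {k - 1..<n}"] k by simp
  qed (use join ij in blast)
qed

lemma spanning_cycle_exists:
  assumes E: "sym E" "irrefl E" "E \<subseteq> V \<times> V"
    and f: "bij_betw f {..<n} V" and n: "n \<ge> 3"
    and k: "0 < k" "k < n"
    and min: "\<And>i. i < n \<Longrightarrow> k \<le> card (E `` {f i})"
    and low: "p \<le> card (E `` {f (k - 1)})"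
    and high: "\<And>i. k \<le> i \<Longrightarrow> i < n \<Longrightarrow> q \<le> card (E `` {f i})"
    and pq: "p \<le> q" "n \<le> p + q"
  shows "\<exists>xs. spanning_cycle V E xs"
proof (rule ccontr)
  assume no_cycle: "\<nexists>xs. spanning_cycle V E xs"
  define C where
    "C = {F. E \<subseteq> F \<and> sym F \<and> irrefl F \<and> F \<subseteq> V \<times> V \<and> (\<nexists>xs. spanning_cycle V F xs)}"
  have finV: "finite V" and cV: "card V = n"
    using f bij_betw_finite bij_betw_same_card[OF f] by auto
  have "finite C" by (rule finite_subset[of _ "Pow (V \<times> V)"]) (auto simp: C_def finV)
  moreover have "E \<in> C" using E no_cycle by (simp add: C_def)
  ultimately obtain F where F: "F \<in> C" and maxF: "\<And>F'. F' \<in> C \<Longrightarrow> F \<subseteq> F' \<Longrightarrow> F = F'"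
    using finite_has_maximal[of C] by blast
  have F': "E \<subseteq> F" "sym F" "irrefl F" "F \<subseteq> V \<times> V" "\<nexists>xs. spanning_cycle V F xs"
    using F by (auto simp: C_def)
  have closed: "ore_closed V F"
    unfolding ore_closed_def
  proof (intro ballI impI, rule ccontr)
    fix u v
    assume uv: "u \<in> V" "v \<in> V" "u \<noteq> v" "card V \<le> card (F `` {u}) + card (F `` {v})" "(u, v) \<notin> F"
    let ?F = "F \<union> {(u, v), (v, u)}"
    \<comment> \<open>\<open>?F\<close> is strictly larger than \<open>F\<close>, hence outside
      \<open>C\<close>; as it keeps all other properties, it must have a spanning cycle.\<close>
    have "?F \<notin> C" using maxF[of ?F] uv(5) by auto
    moreover have "sym ?F" "irrefl ?F" "?F \<subseteq> V \<times> V" "E \<subseteq> ?F"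
      using F' uv by (auto simp: sym_def irrefl_def)
    ultimately obtain xs where "spanning_cycle V ?F xs" by (auto simp: C_def)
    then show False
      using bondy_chvatal[OF F'(2-4), of u v] n cV uv(4) F'(5) by blast
  qed
  have mono: "card (E `` {x}) \<le> card (F `` {x})" for x
    using F'(1,4) finV by (intro card_mono) (auto intro: finite_subset[of _ V])
  have complete: "(f i, f j) \<in> F" if "i < n" "j < n" "i \<noteq> j" for i j
    by (rule ore_closed_complete[OF F'(2,4) closed f k _ _ _ pq that])
      (use min low high mono order_trans in blast)+
  \<comment> \<open>In a complete graph any enumeration is a spanning cycle; its closing pair is
    distinct as \<open>n \<ge> 3\<close>.\<close>
  have "spanning_cycle V F (map f [0..<n])"
    using f n complete
    by (auto simp: spanning_cycle_def bij_betw_def distinct_map successively_map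
        successively_conv_nth last_map hd_map atLeast0LessThan)
  then show False using F'(5) by blast
qed

section \<open>Degree sequences and walks in the digraph\<close>

text \<open>The degree sequence records values only; sorting the vertices themselves by
  \<open>g\<close> recovers a vertex for each term, since a multiset has just one sorted
  list.\<close>

lemma sorted_enumeration:
  assumes "finite V"
  obtains f :: "nat \<Rightarrow> 'a" where "bij_betw f {..<card V} V"
    "\<And>i. i < card V \<Longrightarrow> sorted_list_of_multiset (image_mset g (mset_set V)) ! i = g (f i)"
    "\<And>i j. i \<le> j \<Longrightarrow> j < card V \<Longrightarrow> g (f i) \<le> g (f j)"
proof -
  obtain vs where vs: "set vs = V" "distinct vs" using finite_distinct_list[OF assms] by blast
  define ws where "ws = sort_key g vs"
  have ws: "set ws = V" "distinct ws" "sorted (map g ws)" "length ws = card V"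
    using vs distinct_card[OF vs(2)] by (auto simp: ws_def)
  have "mset_set V = mset ws" using ws(1,2) by (metis mset_set_set)
  then have eq: "sorted_list_of_multiset (image_mset g (mset_set V)) = map g ws"
    using ws(3) sorted_list_of_multiset_mset[of "map g ws"] by (simp add: sorted_sort_id)
  show ?thesis
  proof
    show "bij_betw ((!) ws) {..<card V} V" using ws by (intro bij_betw_nth) auto
  next
    fix i j assume "i \<le> j" "j < card V"
    then show "g (ws ! i) \<le> g (ws ! j)"
      using sorted_nth_mono[OF ws(3), of i j] ws(4) by simp
  qed (simp add: eq ws(4))
qed

text \<open>Without parallel arcs, \<open>head G\<close> is injective on the arcs leaving
  \<open>v\<close>. This moves degrees from arcs to the adjacency relation.\<close>

lemma (in nomulti_digraph) out_degree_conv_arcs_ends: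
  "out_degree G v = card (arcs_ends G `` {v})"
proof -
  have "bij_betw (head G) (out_arcs G v) (arcs_ends G `` {v})"
    using no_multi_arcs
    by (auto simp: bij_betw_def inj_on_def arcs_ends_conv arc_to_ends_def image_iff)
  then show ?thesis unfolding out_degree_def by (rule bij_betw_same_card)
qed

lemma (in wf_digraph) awalk_of_successively:
  assumes "successively (\<lambda>x y. (x, y) \<in> arcs_ends G) xs" "xs \<noteq> []" "set xs \<subseteq> verts G"
  shows "\<exists>p. awalk (hd xs) p (last xs) \<and> awalk_verts (hd xs) p = xs"
  using assms
proof (induction xs)
  case (Cons x xs)
  show ?case
  proof (cases xs)
    case Nil
    then show ?thesis using Cons.prems by (auto intro!: exI[of _ "[]"] simp: awalk_Nil_iff)
  next
    case (Cons y ys)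
    obtain p where "awalk (hd xs) p (last xs)" "awalk_verts (hd xs) p = xs"
      using Cons.IH Cons.prems local.Cons by auto
    moreover obtain e where "e \<in> arcs G" "tail G e = x" "head G e = y"
      using Cons.prems local.Cons by (auto simp: arcs_ends_conv)
    ultimately show ?thesis
      using local.Cons by (intro exI[of _ "e # p"]) (auto simp: awalk_Cons_iff)
  qed
qed simp

lemma (in wf_digraph) hamiltonian_if_spanning_cycle:
  assumes "spanning_cycle (verts G) (arcs_ends G) xs" "card (verts G) \<ge> 3"
  shows "hamiltonian G"
proof -
  have xs: "distinct xs" "set xs = verts G" "successively (\<lambda>x y. (x, y) \<in> arcs_ends G) xs"
    "(last xs, hd xs) \<in> arcs_ends G"
    using assms(1) by (auto simp: spanning_cycle_def)
  have len: "length xs \<ge> 3" using assms(2) distinct_card[OF xs(1)] xs(2) by simp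
  \<comment> \<open>Repeating the first vertex turns the cyclic list into a closed walk with one arc
    per vertex.\<close>
  have "successively (\<lambda>x y. (x, y) \<in> arcs_ends G) (xs @ [hd xs])"
    using xs len by (auto simp: successively_append_iff)
  moreover have "set (xs @ [hd xs]) \<subseteq> verts G" using xs(2) len by (cases xs) auto
  moreover have "hd (xs @ [hd xs]) = hd xs" using len by (cases xs) auto
  ultimately obtain p where p: "awalk (hd xs) p (hd xs)" "awalk_verts (hd xs) p = xs @ [hd xs]"
    using awalk_of_successively[of "xs @ [hd xs]"] by auto
  have lp: "length p = length xs" using p(2) length_awalk_verts[of "hd xs" p] by simp
  then have "p \<noteq> []" using len by auto
  then have tails: "map (tail G) p = xs" using p(2) by (simp add: awalk_verts_conv)
  \<comment> \<open>\<open>cycle\<close> drops the first vertex of the walk before testing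
    distinctness; what remains is \<open>xs\<close> with its head moved to the end.\<close>
  have "distinct (tl (awalk_verts (hd xs) p))"
    using xs(1) len unfolding p(2) by (cases xs) auto
  then have "cycle p" using p(1) lp len by (auto simp: cycle_def)
  moreover have "tail G ` set p = verts G" using tails xs(2) by (metis set_map)
  ultimately show ?thesis using lp len unfolding hamiltonian_def hamilton_cycle_def by auto
qed

theorem theorem1:
  fixes G :: "('a, 'b) pre_digraph" and d :: "nat \<Rightarrow> nat" and n \<delta> :: nat
  assumes "graph G"
    and "n = card (verts G)" and "n \<ge> 3"
    and "d = degree_term G" and "\<delta> = d 1"
    and "d \<delta> + d (\<delta> + 1) \<ge> n"
  shows "hamiltonian G"
proof -
  interpret graph G by fact
  let ?E = "arcs_ends G"
  have E: "sym ?E" "irrefl ?E" "?E \<subseteq> verts G \<times> verts G"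
    using sym_arcs no_loops by (auto simp: symmetric_def irrefl_def arcs_ends_conv)
  obtain f where f: "bij_betw f {..<n} (verts G)"
    and nth: "\<And>i. i < n \<Longrightarrow> degree_sequence G ! i = out_degree G (f i)"
    and mono: "\<And>i j. i \<le> j \<Longrightarrow> j < n \<Longrightarrow> out_degree G (f i) \<le> out_degree G (f j)"
    using sorted_enumeration[OF finite_verts, of "out_degree G"]
    unfolding degree_sequence_def assms(2) by metis
  have d: "d i = out_degree G (f (i - 1))" if "i - 1 < n" for i
    using that nth by (simp add: assms(4) degree_term_def)
  have d1: "\<delta> = out_degree G (f 0)" using d[of 1] assms(3,5) by simp
  \<comment> \<open>A vertex has at most \<open>n - 1\<close> neighbours, so the term of index
    \<open>\<delta> + 1\<close> exists.\<close>
  have "?E `` {f 0} \<subseteq> verts G - {f 0}" using E(2,3) by (auto simp: irrefl_def)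
  then have "\<delta> \<le> card (verts G - {f 0})"
    unfolding d1 out_degree_conv_arcs_ends by (intro card_mono) auto
  moreover have "f 0 \<in> verts G" using f assms(3) by (auto simp: bij_betw_def)
  ultimately have lt: "\<delta> < n" using assms(2,3) by (simp add: card_Diff_singleton)
  \<comment> \<open>If \<open>\<delta>\<close> were 0, then \<open>d 0\<close> and
    \<open>d 1\<close> would both be 0 and their sum could not reach \<open>n\<close>.\<close>
  have pos: "0 < \<delta>"
    using assms(3,6) d[of 0] d[of 1] d1 by (cases "\<delta> = 0") auto
  have "\<exists>xs. spanning_cycle (verts G) ?E xs"
  proof (rule spanning_cycle_exists[OF E f assms(3) pos lt])
    show "\<delta> \<le> card (?E `` {f i})" if "i < n" for i
      using mono[of 0 i] that by (simp add: d1 out_degree_conv_arcs_ends)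
    show "d \<delta> \<le> card (?E `` {f (\<delta> - 1)})"
      using d[of \<delta>] lt by (simp add: out_degree_conv_arcs_ends)
    show "d (\<delta> + 1) \<le> card (?E `` {f i})" if "\<delta> \<le> i" "i < n" for i
      using d[of "\<delta> + 1"] lt mono[of \<delta> i] that by (simp add: out_degree_conv_arcs_ends)
    show "d \<delta> \<le> d (\<delta> + 1)"
      using d[of \<delta>] d[of "\<delta> + 1"] lt mono[of "\<delta> - 1" \<delta>] by simp
  qed (fact assms(6))
  then show ?thesis using hamiltonian_if_spanning_cycle assms(2,3) by blast
qed

end
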